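(* Let $G$ be an f-automatic group with a factorial automatic structure $L_1$ and an automatic structure $L_2$. Let $\varphi$ be an endomorphism of $G$ such that the FT-BRP holds for $(\varphi,L_1,L_2)$. Then the BRP holds for $(\varphi,L_1,L_2)$.
   Context: Maps are written on the right. Let $A$ be a finite alphabet and $\pi:A^*\to G$ a surjective (monoid) homomorphism onto a group $G$. $d_A$ denotes the geodesic (word) metric on the Cayley graph $\Gamma_A(G)$ of $G$ with respect to $A\pi$. For a word $u$, $u^{[n]}$ is its prefix with $n$ letters, and $u^{[n]}=u$ if $n>|u|$. An automatic structure for $\pi$ is a rational (regular) language $L\subseteq A^*$ with $L\pi=G$ such that there is $N\in\mathbb N$ for which all $u,v\in L$ with $d_A(u\pi,v\pi)\le 1$ satisfy $d_A(u^{[n]}\pi,v^{[n]}\pi)\le N$ for all $n\in\mathbb N$ (equivalent to the definition by finite state multiplier automata). An automatic structure is factorial if it is closed under taking factors (contiguous subwords). A group is f-automatic if it admits a factorial automatic structure. Here $L_1$ and $L_2$ are structures for some $\pi_1:A^*\to G$ and $\pi_2:B^*\to G$. Words $u,v\in A^*$ $p$-fellow travel in $\Gamma_A(G)$ if $d_A(u^{[n]}\pi,v^{[n]}\pi)\le p$ for all $n\in\mathbb N$; they are $p$-MFT (meeting fellow travellers) if moreover $u\pi=v\pi$. FT-BRP: the FT-BRP holds for $(\varphi,L_1,L_2)$ if for every $p\ge 0$ there is $q\ge0$ such that: whenever $u_i\in L_1$ and $u_i'\in L_2$ with $u_i'\pi_2=u_i\pi_1\varphi$ for $i=1,2,3$,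 if $u_1u_2$ and $u_3$ are $p$-MFT in $\Gamma_A(G)$, then $u_1'u_2'$ and $u_3'$ are $q$-MFT in $\Gamma_B(G)$. BRP: for a word $u$ and $x\in G$ let $\theta_u^x:\{0,\dots,|u|\}\to G$, $n\mapsto x(u^{[n]}\pi)$ ($\pi$ the relevant homomorphism). The BRP holds for $(\varphi,L_1,L_2)$ if there is $N>0$ such that $\mathrm{Haus}(\mathrm{Im}(\theta_\alpha^x\varphi),\mathrm{Im}(\theta_\beta^{x\varphi}))\le N$ for all $x\in G$, $\alpha\in L_1$, $\beta\in L_2$ with $\beta\pi_2=\alpha\pi_1\varphi$, where $\mathrm{Haus}$ is Hausdorff distance with respect to a word metric of a finite generating set (the choice is irrelevant). *)

theory Defs
  imports "HOL-Algebra.Generated_Groups" "HOL-Library.Sublist" "HOL-Library.Extended_Nat"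
begin

definition free_monoid :: "'a set \<Rightarrow> 'a list monoid"
  where "free_monoid A = \<lparr>carrier = lists A, monoid.mult = (@), one = []\<rparr>"

definition presents :: "('g, 'm) monoid_scheme \<Rightarrow> 'a set \<Rightarrow> ('a list \<Rightarrow> 'g) \<Rightarrow> bool"
  where "presents G A \<pi> \<longleftrightarrow>
    finite A \<and> \<pi> \<in> epi (free_monoid A) G \<and> \<pi> [] = \<one>\<^bsub>G\<^esub>"

definition letters :: "'a set \<Rightarrow> ('a list \<Rightarrow> 'g) \<Rightarrow> 'g set"
  where "letters A \<pi> = (\<lambda>a. \<pi> [a]) ` A"

definition lang_prod :: "'a list set \<Rightarrow> 'a list set \<Rightarrow> 'a list set"
  where "lang_prod K L = {u @ v | u v. u \<in> K \<and> v \<in> L}"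

definition lang_star :: "'a list set \<Rightarrow> 'a list set"
  where "lang_star L = concat ` lists L"

inductive rational :: "'a set \<Rightarrow> 'a list set \<Rightarrow> bool" for A :: "'a set" where
  fin: "finite L \<Longrightarrow> L \<subseteq> lists A \<Longrightarrow> rational A L"
| un: "rational A K \<Longrightarrow> rational A L \<Longrightarrow> rational A (K \<union> L)"
| prod: "rational A K \<Longrightarrow> rational A L \<Longrightarrow> rational A (lang_prod K L)"
| star: "rational A L \<Longrightarrow> rational A (lang_star L)"

definition cayley_adj :: "('g, 'm) monoid_scheme \<Rightarrow> 'g set \<Rightarrow> 'g \<Rightarrow> 'g \<Rightarrow> bool"
  where "cayley_adj G S g h \<longleftrightarrow> g \<in> carrier G \<and> h \<in> carrier G \<and>
    (\<exists>s\<in>S. h = g \<otimes>\<^bsub>G\<^esub> s \<or> g = h \<otimes>\<^bsub>G\<^esub> s)"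

text \<open>
  Geodesic distance in the Cayley graph. Edges may be traversed in both directions, as
  \<open>S\<close> need not be closed under inverses. The value is meaningful only if \<open>S\<close>
  generates \<open>G\<close>, since otherwise some pairs of vertices are not joined by any path.
\<close>

definition word_dist :: "('g, 'm) monoid_scheme \<Rightarrow> 'g set \<Rightarrow> 'g \<Rightarrow> 'g \<Rightarrow> nat"
  where "word_dist G S g h = (LEAST n. (cayley_adj G S ^^ n) g h)"

definition fellow_travel ::
    "('g, 'm) monoid_scheme \<Rightarrow> 'a set \<Rightarrow> ('a list \<Rightarrow> 'g) \<Rightarrow> nat \<Rightarrow> 'a list \<Rightarrow> 'a list \<Rightarrow> bool"
  where "fellow_travel G A \<pi> p u v \<longleftrightarrow>
    (\<forall>n. word_dist G (letters A \<pi>) (\<pi> (take n u)) (\<pi> (take n v)) \<le> p)"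

definition MFT ::
    "('g, 'm) monoid_scheme \<Rightarrow> 'a set \<Rightarrow> ('a list \<Rightarrow> 'g) \<Rightarrow> nat \<Rightarrow> 'a list \<Rightarrow> 'a list \<Rightarrow> bool"
  where "MFT G A \<pi> p u v \<longleftrightarrow> fellow_travel G A \<pi> p u v \<and> \<pi> u = \<pi> v"

definition automatic_structure ::
    "('g, 'm) monoid_scheme \<Rightarrow> 'a set \<Rightarrow> ('a list \<Rightarrow> 'g) \<Rightarrow> 'a list set \<Rightarrow> bool"
  where "automatic_structure G A \<pi> L \<longleftrightarrow>
    L \<subseteq> lists A \<and> rational A L \<and> \<pi> ` L = carrier G \<and>
    (\<exists>N. \<forall>u\<in>L. \<forall>v\<in>L. word_dist G (letters A \<pi>) (\<pi> u) (\<pi> v) \<le> 1 \<longrightarrow>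
       fellow_travel G A \<pi> N u v)"

definition factorial_lang :: "'a list set \<Rightarrow> bool"
  where "factorial_lang L \<longleftrightarrow> (\<forall>w\<in>L. \<forall>u. sublist u w \<longrightarrow> u \<in> L)"

definition FT_BRP ::
    "('g, 'm) monoid_scheme \<Rightarrow> 'a set \<Rightarrow> ('a list \<Rightarrow> 'g) \<Rightarrow> 'b set \<Rightarrow> ('b list \<Rightarrow> 'g) \<Rightarrow>
     ('g \<Rightarrow> 'g) \<Rightarrow> 'a list set \<Rightarrow> 'b list set \<Rightarrow> bool"
  where "FT_BRP G A \<pi>\<^sub>1 B \<pi>\<^sub>2 \<phi> L\<^sub>1 L\<^sub>2 \<longleftrightarrow>
    (\<forall>p. \<exists>q. \<forall>u\<^sub>1\<in>L\<^sub>1. \<forall>u\<^sub>2\<in>L\<^sub>1. \<forall>u\<^sub>3\<in>L\<^sub>1. \<forall>v\<^sub>1\<in>L\<^sub>2. \<forall>v\<^sub>2\<in>L\<^sub>2. \<forall>v\<^sub>3\<in>L\<^sub>2.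
       \<pi>\<^sub>2 v\<^sub>1 = \<phi> (\<pi>\<^sub>1 u\<^sub>1) \<and> \<pi>\<^sub>2 v\<^sub>2 = \<phi> (\<pi>\<^sub>1 u\<^sub>2) \<and> \<pi>\<^sub>2 v\<^sub>3 = \<phi> (\<pi>\<^sub>1 u\<^sub>3) \<longrightarrow>
       MFT G A \<pi>\<^sub>1 p (u\<^sub>1 @ u\<^sub>2) u\<^sub>3 \<longrightarrow> MFT G B \<pi>\<^sub>2 q (v\<^sub>1 @ v\<^sub>2) v\<^sub>3)"

text \<open>Taken in \<^typ>\<open>enat\<close>, so that suprema and infima are never those of an
  unbounded or empty set of natural numbers.\<close>

definition Haus :: "('g \<Rightarrow> 'g \<Rightarrow> nat) \<Rightarrow> 'g set \<Rightarrow> 'g set \<Rightarrow> enat"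
  where "Haus d X Y =
    max (SUP x\<in>X. INF y\<in>Y. enat (d x y)) (SUP y\<in>Y. INF x\<in>X. enat (d x y))"

definition theta ::
    "('g, 'm) monoid_scheme \<Rightarrow> ('a list \<Rightarrow> 'g) \<Rightarrow> 'g \<Rightarrow> 'a list \<Rightarrow> nat \<Rightarrow> 'g"
  where "theta G \<pi> x u n = x \<otimes>\<^bsub>G\<^esub> \<pi> (take n u)"

text \<open>\<open>S\<close> is the finite generating set whose word metric defines the Hausdorff
  distance.\<close>

definition BRP ::
    "('g, 'm) monoid_scheme \<Rightarrow> 'g set \<Rightarrow> ('a list \<Rightarrow> 'g) \<Rightarrow> ('b list \<Rightarrow> 'g) \<Rightarrow>
     ('g \<Rightarrow> 'g) \<Rightarrow> 'a list set \<Rightarrow> 'b list set \<Rightarrow> bool"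
  where "BRP G S \<pi>\<^sub>1 \<pi>\<^sub>2 \<phi> L\<^sub>1 L\<^sub>2 \<longleftrightarrow>
    (\<exists>N::nat. N > 0 \<and> (\<forall>x\<in>carrier G. \<forall>\<alpha>\<in>L\<^sub>1. \<forall>\<beta>\<in>L\<^sub>2. \<pi>\<^sub>2 \<beta> = \<phi> (\<pi>\<^sub>1 \<alpha>) \<longrightarrow>
       Haus (word_dist G S)
         ((\<phi> \<circ> theta G \<pi>\<^sub>1 x \<alpha>) ` {0..length \<alpha>})
         (theta G \<pi>\<^sub>2 (\<phi> x) \<beta> ` {0..length \<beta>}) \<le> enat N))"

end

theory Submission
  imports Defs
begin

text \<open>
  The FT-BRP enters through its instance \<open>p = 0\<close>: since \<open>L\<^sub>1\<close> is factorial, a word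
  \<open>u\<^sub>1 @ u\<^sub>2\<close> of \<open>L\<^sub>1\<close> is \<open>0\<close>-MFT with itself and both factors lie in \<open>L\<^sub>1\<close>. So there
  is one constant \<open>q\<close> such that representatives in \<open>L\<^sub>2\<close> of the images of \<open>u\<^sub>1\<close> and \<open>u\<^sub>2\<close>
  can be concatenated, and the result \<open>q\<close>-fellow travels with every representative of the image
  of \<open>u\<^sub>1 @ u\<^sub>2\<close>.

  Let \<open>\<alpha>\<close> in \<open>L\<^sub>1\<close> have length \<open>n\<close>, let \<open>\<beta>\<close> in \<open>L\<^sub>2\<close> represent its image, and let
  \<open>v\<^sub>i\<close> in \<open>L\<^sub>2\<close> be a chosen representative of the image of the prefix \<open>\<alpha>\<^sub>i\<close> of length \<open>i\<close>.
  Cutting \<open>\<alpha>\<close> after \<open>i\<close> letters shows that \<open>v\<^sub>i\<close> and \<open>\<beta>\<close> are \<open>q\<close>-close at every time \<open>m \<le> |v\<^sub>i|\<close>. At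
  \<open>m = |v\<^sub>i|\<close> this says that the image of \<open>\<alpha>\<^sub>i\<close> is \<open>q\<close>-close to the path of \<open>\<beta>\<close>
  (lemma \<open>image_of_prefix_near_path\<close>).

  Conversely (lemma \<open>point_of_path_near_image\<close>), take a point of the path of \<open>\<beta>\<close>, at time \<open>m\<close>.
  Put \<open>v\<^sub>n\<^sub>+\<^sub>1 = \<beta>\<close>. If \<open>m \<le> |v\<^sub>0|\<close>, the point is \<open>q\<close>-close to
  the path of \<open>v\<^sub>0\<close>, one fixed representative of the identity. Otherwise there
  is an \<open>i\<close> with \<open>|v\<^sub>i| < m \<le> |v\<^sub>i\<^sub>+\<^sub>1|\<close>. At time \<open>m\<close> the word \<open>\<beta>\<close> is \<open>q\<close>-close to
  \<open>v\<^sub>i\<^sub>+\<^sub>1\<close>; and \<open>v\<^sub>i\<^sub>+\<^sub>1\<close> is \<open>q\<close>-close to \<open>v\<^sub>i @ w\<close>, where \<open>w\<close> represents the image of at most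
  one letter. As \<open>v\<^sub>i\<close> is already used up at time \<open>m\<close>, the latter is within \<open>|w|\<close> of the end of
  \<open>v\<^sub>i\<close>, which is the image of \<open>\<alpha>\<^sub>i\<close>. There are finitely many letters, so \<open>|w|\<close> is bounded.

  It remains to translate by the image of \<open>x\<close>, which is an isometry, and to replace the letters of
  \<open>B\<close> by the generating set \<open>S\<close>, which changes distances by at most a constant factor.
\<close>

section \<open>Word metrics\<close>

locale generated_group = group G for G :: "('g, 'm) monoid_scheme" (structure) +
  fixes S :: "'g set"
  assumes gens_closed: "S \<subseteq> carrier G"
    and gens_generate: "generate G S = carrier G"
begin

abbreviation walk :: "nat \<Rightarrow> 'g \<Rightarrow> 'g \<Rightarrow> bool"
  where "walk n \<equiv> cayley_adj G S ^^ n"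

abbreviation dist :: "'g \<Rightarrow> 'g \<Rightarrow> nat"
  where "dist \<equiv> word_dist G S"

lemma cayley_adj_translate:
  assumes "x \<in> carrier G" "cayley_adj G S g h"
  shows "cayley_adj G S (x \<otimes> g) (x \<otimes> h)"
  using assms gens_closed unfolding cayley_adj_def
  by (auto simp: m_assoc subset_iff)

lemma walk_translate:
  assumes "x \<in> carrier G" "walk n g h"
  shows "walk n (x \<otimes> g) (x \<otimes> h)"
  using assms(2)
proof (induction n arbitrary: h)
  case (Suc n)
  then obtain k where "walk n g k" "cayley_adj G S k h"
    by (auto elim: relpowp_Suc_E)
  with Suc.IH show ?case
    using cayley_adj_translate[OF assms(1)] by (blast intro: relpowp_Suc_I)
qed simp

lemma walk_sym: "walk n g h \<Longrightarrow> walk n h g"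
proof (induction n arbitrary: h)
  case (Suc n)
  then obtain k where "walk n g k" "cayley_adj G S k h"
    by (auto elim: relpowp_Suc_E)
  moreover from this have "cayley_adj G S h k"
    by (auto simp: cayley_adj_def)
  ultimately show ?case
    using Suc.IH by (blast intro: relpowp_Suc_I2)
qed simp

lemma walk_trans: "walk m g h \<Longrightarrow> walk n h k \<Longrightarrow> walk (m + n) g k"
  by (auto simp: relpowp_add)

lemma walk_edge: "cayley_adj G S g h \<Longrightarrow> walk 1 g h"
  by (metis relpowp_1)

lemma ex_walk_from_one: "g \<in> generate G S \<Longrightarrow> \<exists>n. walk n \<one> g"
proof (induction rule: generate.induct)
  case one
  have "walk 0 \<one> \<one>" by simp
  then show ?case by blast
next
  case (incl h)
  then have "cayley_adj G S \<one> h"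
    using gens_closed by (auto simp: cayley_adj_def intro!: bexI[of _ h])
  then have "walk 1 \<one> h" by (rule walk_edge)
  then show ?case by blast
next
  case (inv h)
  then have "cayley_adj G S \<one> (inv h)"
    using gens_closed by (auto simp: cayley_adj_def intro!: bexI[of _ h])
  then have "walk 1 \<one> (inv h)" by (rule walk_edge)
  then show ?case by blast
next
  case (eng h k)
  then obtain m n where "walk m \<one> h" "walk n \<one> k" by blast
  moreover have "h \<in> carrier G"
    using eng.hyps gens_generate by simp
  ultimately have "walk (m + n) \<one> (h \<otimes> k)"
    using walk_translate[of h n \<one> k] walk_trans by simp
  then show ?case by blast
qed

lemma walk_dist:
  assumes "g \<in> carrier G" "h \<in> carrier G"
  shows "walk (dist g h) g h"
proof -
  obtain n where "walk n \<one> (inv g \<otimes> h)"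
    using ex_walk_from_one[of "inv g \<otimes> h"] assms gens_generate by auto
  then have "walk n (g \<otimes> \<one>) (g \<otimes> (inv g \<otimes> h))"
    using assms(1) walk_translate by blast
  then have "walk n g h"
    using assms by (simp add: m_assoc[symmetric])
  then show ?thesis
    unfolding word_dist_def by (rule LeastI)
qed

lemma dist_le: "walk n g h \<Longrightarrow> dist g h \<le> n"
  unfolding word_dist_def by (rule Least_le)

lemma dist_self: "dist g g = 0"
  using dist_le[of 0 g g] by simp

lemma dist_sym_le:
  assumes "g \<in> carrier G" "h \<in> carrier G" "dist g h \<le> n"
  shows "dist h g \<le> n"
  using dist_le[OF walk_sym[OF walk_dist]] assms by (blast intro: le_trans)

lemma dist_triangle:
  assumes "g \<in> carrier G" "h \<in> carrier G" "k \<in> carrier G"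
    and "dist g h \<le> m" "dist h k \<le> n"
  shows "dist g k \<le> m + n"
  using dist_le[OF walk_trans[OF walk_dist walk_dist], of g h k] assms by simp

lemma dist_translate_le:
  assumes "x \<in> carrier G" "g \<in> carrier G" "h \<in> carrier G"
  shows "dist (x \<otimes> g) (x \<otimes> h) \<le> dist g h"
  using assms by (blast intro: dist_le walk_translate walk_dist)

text \<open>Every edge for another finite set of generators becomes a path of bounded length, which
  gives one half of the bi-Lipschitz equivalence of word metrics.\<close>

lemma dist_le_mult_other_dist:
  assumes "generated_group G T" "finite T"
  shows "\<exists>K. \<forall>g\<in>carrier G. \<forall>h\<in>carrier G. dist g h \<le> K * word_dist G T g h"
proof -
  interpret T: generated_group G T by fact
  define K where "K = (\<Sum>t\<in>T. dist \<one> t)"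
  have edge: "dist g h \<le> K" if adj: "cayley_adj G T g h" for g h
  proof -
    from adj have carr: "g \<in> carrier G" "h \<in> carrier G"
      by (auto simp: cayley_adj_def)
    have step: "dist k (k \<otimes> t) \<le> K" if "k \<in> carrier G" "t \<in> T" for k t
    proof -
      have "t \<in> carrier G"
        using that T.gens_closed by blast
      then have "dist k (k \<otimes> t) \<le> dist \<one> t"
        using dist_translate_le[of k \<one> t] that by simp
      also have "\<dots> \<le> K"
        unfolding K_def using that assms(2) by (intro member_le_sum) auto
      finally show ?thesis .
    qed
    from adj obtain t where "t \<in> T" "h = g \<otimes> t \<or> g = h \<otimes> t"
      by (auto simp: cayley_adj_def)
    then show ?thesis
      using step carr dist_sym_le by blast
  qed
  have "dist g h \<le> K * n" if "T.walk n g h" "g \<in> carrier G" for n g h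
    using that(1)
  proof (induction n arbitrary: h)
    case 0
    then show ?case by (simp add: dist_self)
  next
    case (Suc n)
    then obtain k where k: "T.walk n g k" "cayley_adj G T k h"
      by (auto elim: relpowp_Suc_E)
    then have "k \<in> carrier G" "h \<in> carrier G"
      by (auto simp: cayley_adj_def)
    then have "dist g h \<le> K * n + K"
      using dist_triangle[OF that(2)] Suc.IH[OF k(1)] edge[OF k(2)] by blast
    then show ?case by simp
  qed
  then show ?thesis
    using T.walk_dist by blast
qed

end

lemma Haus_le:
  assumes "\<And>x. x \<in> X \<Longrightarrow> \<exists>y\<in>Y. d x y \<le> N"
    and "\<And>y. y \<in> Y \<Longrightarrow> \<exists>x\<in>X. d x y \<le> N"
  shows "Haus d X Y \<le> enat N"
  unfolding Haus_def
proof (intro max.boundedI SUP_least)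
  fix x assume "x \<in> X"
  then obtain y where "y \<in> Y" "d x y \<le> N" using assms(1) by blast
  then show "(INF y\<in>Y. enat (d x y)) \<le> enat N" by (auto intro: INF_lower2)
next
  fix y assume "y \<in> Y"
  then obtain x where "x \<in> X" "d x y \<le> N" using assms(2) by blast
  then show "(INF x\<in>X. enat (d x y)) \<le> enat N" by (auto intro: INF_lower2)
qed

section \<open>Words over a presenting alphabet\<close>

locale presented_group = group G for G :: "('g, 'm) monoid_scheme" (structure) +
  fixes A :: "'a set" and \<pi> :: "'a list \<Rightarrow> 'g"
  assumes presents: "presents G A \<pi>"
begin

lemma finite_alphabet: "finite A"
  using presents by (simp add: presents_def)

lemma eval_Nil: "\<pi> [] = \<one>"
  using presents by (simp add: presents_def)

lemma eval_closed: "u \<in> lists A \<Longrightarrow> \<pi> u \<in> carrier G"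
  using presents by (auto simp: presents_def epi_def hom_def free_monoid_def)

lemma eval_append: "u \<in> lists A \<Longrightarrow> v \<in> lists A \<Longrightarrow> \<pi> (u @ v) = \<pi> u \<otimes> \<pi> v"
  using presents by (simp add: presents_def epi_def hom_def free_monoid_def)

lemma eval_surj: "\<pi> ` lists A = carrier G"
  using presents by (simp add: presents_def epi_def free_monoid_def)

lemma letters_closed: "letters A \<pi> \<subseteq> carrier G"
  by (auto simp: letters_def intro!: eval_closed)

lemma eval_in_generate: "u \<in> lists A \<Longrightarrow> \<pi> u \<in> generate G (letters A \<pi>)"
proof (induction u)
  case Nil
  then show ?case by (simp add: eval_Nil generate.one)
next
  case (Cons a u)
  then have "\<pi> (a # u) = \<pi> [a] \<otimes> \<pi> u"
    using eval_append[of "[a]" u] by simp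
  moreover have "\<pi> [a] \<in> generate G (letters A \<pi>)"
    using Cons.prems by (auto simp: letters_def intro!: generate.incl)
  ultimately show ?case
    using Cons by (simp add: generate.eng)
qed

sublocale generated_group G "letters A \<pi>"
proof
  show "letters A \<pi> \<subseteq> carrier G" by (rule letters_closed)
  show "generate G (letters A \<pi>) = carrier G"
  proof
    show "generate G (letters A \<pi>) \<subseteq> carrier G"
      by (rule generate_incl) (rule letters_closed)
    show "carrier G \<subseteq> generate G (letters A \<pi>)"
      unfolding eval_surj[symmetric] using eval_in_generate by (rule image_subsetI)
  qed
qed

lemma take_in_lists: "u \<in> lists A \<Longrightarrow> take n u \<in> lists A"
  by (auto dest: in_set_takeD)

lemma dist_eval_append:
  "u \<in> lists A \<Longrightarrow> w \<in> lists A \<Longrightarrow> dist (\<pi> u) (\<pi> (u @ w)) \<le> length w"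
proof (induction w rule: rev_induct)
  case Nil
  then show ?case by (simp add: dist_self)
next
  case (snoc a w)
  then have carr: "\<pi> u \<in> carrier G" "\<pi> (u @ w) \<in> carrier G" "\<pi> (u @ w @ [a]) \<in> carrier G"
    by (auto intro!: eval_closed)
  have "\<pi> (u @ w @ [a]) = \<pi> (u @ w) \<otimes> \<pi> [a]"
    using eval_append[of "u @ w" "[a]"] snoc.prems by simp
  then have "cayley_adj G (letters A \<pi>) (\<pi> (u @ w)) (\<pi> (u @ w @ [a]))"
    using carr snoc.prems by (auto simp: cayley_adj_def letters_def)
  then have "dist (\<pi> (u @ w)) (\<pi> (u @ w @ [a])) \<le> 1"
    by (intro dist_le walk_edge)
  moreover have "dist (\<pi> u) (\<pi> (u @ w)) \<le> length w"
    using snoc by simp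
  ultimately show ?case
    using dist_triangle[OF carr, of "length w" 1] by simp
qed

lemma fellow_travel_prefix_near:
  assumes "fellow_travel G A \<pi> q (v @ w) z" "m \<le> length v"
  shows "dist (\<pi> (take m v)) (\<pi> (take m z)) \<le> q"
  using assms unfolding fellow_travel_def by (metis take_append diff_is_0_eq' take0 append_Nil2)

lemma fellow_travel_end_near:
  assumes ft: "fellow_travel G A \<pi> q (v @ w) z" and "length v \<le> m"
    and words: "v \<in> lists A" "w \<in> lists A" "z \<in> lists A"
  shows "dist (\<pi> v) (\<pi> (take m z)) \<le> length w + q"
proof (rule dist_triangle)
  let ?w = "take (m - length v) w"
  have w: "?w \<in> lists A" using words(2) by (rule take_in_lists)
  show "dist (\<pi> v) (\<pi> (v @ ?w)) \<le> length w"
    using dist_eval_append[OF words(1) w] by simp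
  have "take m (v @ w) = v @ ?w" using assms(2) by simp
  then show "dist (\<pi> (v @ ?w)) (\<pi> (take m z)) \<le> q"
    using ft unfolding fellow_travel_def by metis
  show "\<pi> v \<in> carrier G" "\<pi> (take m z) \<in> carrier G" "\<pi> (v @ ?w) \<in> carrier G"
    using words w take_in_lists[of z m] by (auto intro!: eval_closed)
qed

end

section \<open>Transporting factorisations along the endomorphism\<close>

text \<open>The assumption \<open>cut\<close> is what the FT-BRP gives for \<open>p = 0\<close> when \<open>L\<^sub>1\<close> is factorial.\<close>

locale cut_transport =
  A: presented_group G A \<pi>\<^sub>1 + B: presented_group G B \<pi>\<^sub>2
  for G :: "('g, 'm) monoid_scheme" (structure)
    and A :: "'a set" and \<pi>\<^sub>1 :: "'a list \<Rightarrow> 'g"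
    and B :: "'b set" and \<pi>\<^sub>2 :: "'b list \<Rightarrow> 'g" +
  fixes L\<^sub>1 :: "'a list set" and L\<^sub>2 :: "'b list set" and \<phi> :: "'g \<Rightarrow> 'g" and q :: nat
  assumes hom: "\<phi> \<in> hom G G"
    and L1_words: "L\<^sub>1 \<subseteq> lists A" and L2_words: "L\<^sub>2 \<subseteq> lists B"
    and L2_onto: "\<pi>\<^sub>2 ` L\<^sub>2 = carrier G"
    and factorial: "factorial_lang L\<^sub>1"
    and cut: "\<And>u\<^sub>1 u\<^sub>2 v\<^sub>1 v\<^sub>2 v\<^sub>3. u\<^sub>1 @ u\<^sub>2 \<in> L\<^sub>1 \<Longrightarrow> v\<^sub>1 \<in> L\<^sub>2 \<Longrightarrow> v\<^sub>2 \<in> L\<^sub>2 \<Longrightarrow> v\<^sub>3 \<in> L\<^sub>2 \<Longrightarrow>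
      \<pi>\<^sub>2 v\<^sub>1 = \<phi> (\<pi>\<^sub>1 u\<^sub>1) \<Longrightarrow> \<pi>\<^sub>2 v\<^sub>2 = \<phi> (\<pi>\<^sub>1 u\<^sub>2) \<Longrightarrow> \<pi>\<^sub>2 v\<^sub>3 = \<phi> (\<pi>\<^sub>1 (u\<^sub>1 @ u\<^sub>2)) \<Longrightarrow>
      fellow_travel G B \<pi>\<^sub>2 q (v\<^sub>1 @ v\<^sub>2) v\<^sub>3"
begin

lemma prefix_in_L1: "\<alpha> \<in> L\<^sub>1 \<Longrightarrow> take i \<alpha> \<in> L\<^sub>1"
  using factorial unfolding factorial_lang_def by (meson sublist_take)

definition rep :: "'a list \<Rightarrow> 'b list"
  where "rep u = (SOME v. v \<in> L\<^sub>2 \<and> \<pi>\<^sub>2 v = \<phi> (\<pi>\<^sub>1 u))"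

lemma rep:
  assumes "u \<in> lists A"
  shows "rep u \<in> L\<^sub>2" "\<pi>\<^sub>2 (rep u) = \<phi> (\<pi>\<^sub>1 u)"
proof -
  have "\<phi> (\<pi>\<^sub>1 u) \<in> carrier G"
    using hom A.eval_closed[OF assms] by (auto simp: hom_def)
  then have "\<exists>v. v \<in> L\<^sub>2 \<and> \<pi>\<^sub>2 v = \<phi> (\<pi>\<^sub>1 u)"
    using L2_onto by (metis imageE)
  from someI_ex[OF this] show "rep u \<in> L\<^sub>2" "\<pi>\<^sub>2 (rep u) = \<phi> (\<pi>\<^sub>1 u)"
    by (simp_all add: rep_def)
qed

lemma prefix_rep_near:
  assumes "\<alpha> \<in> L\<^sub>1" "\<beta> \<in> L\<^sub>2" "\<pi>\<^sub>2 \<beta> = \<phi> (\<pi>\<^sub>1 \<alpha>)" and m: "m \<le> length (rep (take i \<alpha>))"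
  shows "B.dist (\<pi>\<^sub>2 (take m (rep (take i \<alpha>)))) (\<pi>\<^sub>2 (take m \<beta>)) \<le> q"
proof (rule B.fellow_travel_prefix_near[OF _ m])
  have "\<alpha> \<in> lists A" using assms(1) L1_words by blast
  then have "take i \<alpha> \<in> lists A" "drop i \<alpha> \<in> lists A"
    by (auto dest: in_set_takeD in_set_dropD)
  then show "fellow_travel G B \<pi>\<^sub>2 q (rep (take i \<alpha>) @ rep (drop i \<alpha>)) \<beta>"
    using assms by (intro cut[of "take i \<alpha>" "drop i \<alpha>"] rep) simp_all
qed

lemma image_of_prefix_near_path:
  assumes "\<alpha> \<in> L\<^sub>1" "\<beta> \<in> L\<^sub>2" "\<pi>\<^sub>2 \<beta> = \<phi> (\<pi>\<^sub>1 \<alpha>)"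
  shows "\<exists>m\<le>length \<beta>. B.dist (\<phi> (\<pi>\<^sub>1 (take i \<alpha>))) (\<pi>\<^sub>2 (take m \<beta>)) \<le> q"
proof (intro exI conjI)
  let ?l = "length (rep (take i \<alpha>))"
  have "take i \<alpha> \<in> lists A" using assms(1) L1_words prefix_in_L1 by blast
  then show "B.dist (\<phi> (\<pi>\<^sub>1 (take i \<alpha>))) (\<pi>\<^sub>2 (take (min ?l (length \<beta>)) \<beta>)) \<le> q"
    using prefix_rep_near[OF assms order.refl, of i] rep(2)
    by (metis min.commute take_all take_take order.refl)
  show "min ?l (length \<beta>) \<le> length \<beta>" by simp
qed

text \<open>The words with at most one letter are the increments between successive prefixes.\<close>

definition increment_bound :: nat
  where "increment_bound = Max ((\<lambda>c. length (rep c)) ` {c \<in> lists A. length c \<le> 1})"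

lemma length_rep_increment: "c \<in> lists A \<Longrightarrow> length c \<le> 1 \<Longrightarrow> length (rep c) \<le> increment_bound"
  unfolding increment_bound_def
  using finite_lists_length_le[OF A.finite_alphabet, of 1]
  by (intro Max_ge) (auto simp: lists_eq_set)

lemma ex_crossing:
  fixes f :: "nat \<Rightarrow> nat"
  assumes "f 0 < m" "m \<le> f (Suc n)"
  shows "\<exists>i\<le>n. f i < m \<and> m \<le> f (Suc i)"
  using assms
proof (induction n)
  case (Suc n)
  show ?case
  proof (cases "m \<le> f (Suc n)")
    case True
    then show ?thesis using Suc by (meson le_SucI)
  next
    case False
    then show ?thesis using Suc.prems by (intro exI[of _ "Suc n"]) simp
  qed
qed auto

lemma point_of_path_near_image:
  assumes \<alpha>: "\<alpha> \<in> L\<^sub>1" and \<beta>: "\<beta> \<in> L\<^sub>2" "\<pi>\<^sub>2 \<beta> = \<phi> (\<pi>\<^sub>1 \<alpha>)" and m: "m \<le> length \<beta>"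
  shows "\<exists>i\<le>length \<alpha>.
    B.dist (\<phi> (\<pi>\<^sub>1 (take i \<alpha>))) (\<pi>\<^sub>2 (take m \<beta>)) \<le> increment_bound + 2 * q"
proof -
  have words: "\<alpha> \<in> lists A" "\<beta> \<in> lists B" "take i \<alpha> \<in> lists A" for i
    using \<alpha> \<beta>(1) L1_words L2_words prefix_in_L1 by blast+
  have take_\<beta>: "take m \<beta> \<in> lists B"
    by (intro B.take_in_lists words)
  \<comment> \<open>Ending the chain of representatives with \<open>\<beta>\<close> itself ensures that some length reaches \<open>m\<close>;
    as \<open>\<alpha>\<close> is also its own prefix of length \<open>Suc (length \<alpha>)\<close>, that last step is one more
    increment, by the empty word.\<close>
  define v where "v i = (if i \<le> length \<alpha> then rep (take i \<alpha>) else \<beta>)" for i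
  have v: "v i \<in> L\<^sub>2" "\<pi>\<^sub>2 (v i) = \<phi> (\<pi>\<^sub>1 (take i \<alpha>))" for i
    using rep[OF words(3)] \<beta> by (auto simp: v_def)
  then have v_words: "v i \<in> lists B" "take m (v i) \<in> lists B" for i
    using L2_words B.take_in_lists by blast+
  have v_near: "B.dist (\<pi>\<^sub>2 (take m (v i))) (\<pi>\<^sub>2 (take m \<beta>)) \<le> q" if "m \<le> length (v i)" for i
    using prefix_rep_near[OF \<alpha> \<beta>] that by (auto simp: v_def B.dist_self)
  show ?thesis
  proof (cases "m \<le> length (v 0)")
    case True
    have "length (v 0) \<le> increment_bound"
      using length_rep_increment[of "[]"] by (simp add: v_def)
    moreover have "B.dist (\<pi>\<^sub>2 []) (\<pi>\<^sub>2 ([] @ take m (v 0))) \<le> length (take m (v 0))"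
      by (rule B.dist_eval_append) (simp_all add: v_words del: in_lists_conv_set)
    ultimately have "B.dist \<one> (\<pi>\<^sub>2 (take m (v 0))) \<le> increment_bound"
      by (simp add: B.eval_Nil)
    then have "B.dist \<one> (\<pi>\<^sub>2 (take m \<beta>)) \<le> increment_bound + q"
      using v_near[OF True]
      by (rule B.dist_triangle[OF A.one_closed B.eval_closed[OF v_words(2)] B.eval_closed[OF take_\<beta>]])
    moreover have "\<phi> (\<pi>\<^sub>1 (take 0 \<alpha>)) = \<one>"
      using hom_one[OF hom] A.is_group by (simp add: A.eval_Nil)
    ultimately show ?thesis by (intro exI[of _ 0]) simp
  next
    case False
    moreover have "m \<le> length (v (Suc (length \<alpha>)))"
      using m by (simp add: v_def)
    ultimately obtain i where i: "i \<le> length \<alpha>" "length (v i) < m" "m \<le> length (v (Suc i))"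
      using ex_crossing[of "\<lambda>i. length (v i)"] by (meson not_le)
    define c where "c = take 1 (drop i \<alpha>)"
    have "c \<in> lists A"
      using words(1) by (auto simp: c_def dest!: in_set_takeD in_set_dropD)
    then have c: "rep c \<in> L\<^sub>2" "\<pi>\<^sub>2 (rep c) = \<phi> (\<pi>\<^sub>1 c)" "length (rep c) \<le> increment_bound"
      using rep length_rep_increment by (auto simp: c_def)
    have step: "take i \<alpha> @ c = take (Suc i) \<alpha>"
      unfolding c_def by (metis Suc_eq_plus1 take_add)
    then have "fellow_travel G B \<pi>\<^sub>2 q (v i @ rep c) (v (Suc i))"
      using v c prefix_in_L1[OF \<alpha>] by (intro cut[of "take i \<alpha>" c]) auto
    then have "B.dist (\<pi>\<^sub>2 (v i)) (\<pi>\<^sub>2 (take m (v (Suc i)))) \<le> length (rep c) + q"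
      using i(2) v_words c(1) L2_words by (intro B.fellow_travel_end_near) auto
    then have "B.dist (\<pi>\<^sub>2 (v i)) (\<pi>\<^sub>2 (take m \<beta>)) \<le> (length (rep c) + q) + q"
      using v_near[OF i(3)]
      by (rule B.dist_triangle[OF B.eval_closed[OF v_words(1)] B.eval_closed[OF v_words(2)]
            B.eval_closed[OF take_\<beta>]])
    then show ?thesis using c(3) i(1) v(2)[of i] by (intro exI[of _ i]) simp
  qed
qed

end

theorem proposition3p5:
  fixes G :: "('g, 'm) monoid_scheme"
    and A :: "'a set" and B :: "'b set"
    and \<pi>\<^sub>1 :: "'a list \<Rightarrow> 'g" and \<pi>\<^sub>2 :: "'b list \<Rightarrow> 'g"
    and L\<^sub>1 :: "'a list set" and L\<^sub>2 :: "'b list set"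
    and \<phi> :: "'g \<Rightarrow> 'g" and S :: "'g set"
  assumes "group G"
    and "presents G A \<pi>\<^sub>1" and "presents G B \<pi>\<^sub>2"
    and "automatic_structure G A \<pi>\<^sub>1 L\<^sub>1" and "factorial_lang L\<^sub>1"
    and "automatic_structure G B \<pi>\<^sub>2 L\<^sub>2"
    and "\<phi> \<in> hom G G"
    and "FT_BRP G A \<pi>\<^sub>1 B \<pi>\<^sub>2 \<phi> L\<^sub>1 L\<^sub>2"
    and "finite S" and "S \<subseteq> carrier G" and "generate G S = carrier G"
  shows "BRP G S \<pi>\<^sub>1 \<pi>\<^sub>2 \<phi> L\<^sub>1 L\<^sub>2"
proof -
  interpret group G by fact
  interpret A: presented_group G A \<pi>\<^sub>1 by unfold_locales fact
  interpret B: presented_group G B \<pi>\<^sub>2 by unfold_locales fact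
  interpret S: generated_group G S by unfold_locales fact+
  from assms(8) obtain q where q: "\<And>u\<^sub>1 u\<^sub>2 u\<^sub>3 v\<^sub>1 v\<^sub>2 v\<^sub>3.
      u\<^sub>1 \<in> L\<^sub>1 \<Longrightarrow> u\<^sub>2 \<in> L\<^sub>1 \<Longrightarrow> u\<^sub>3 \<in> L\<^sub>1 \<Longrightarrow> v\<^sub>1 \<in> L\<^sub>2 \<Longrightarrow> v\<^sub>2 \<in> L\<^sub>2 \<Longrightarrow> v\<^sub>3 \<in> L\<^sub>2 \<Longrightarrow>
      \<pi>\<^sub>2 v\<^sub>1 = \<phi> (\<pi>\<^sub>1 u\<^sub>1) \<Longrightarrow> \<pi>\<^sub>2 v\<^sub>2 = \<phi> (\<pi>\<^sub>1 u\<^sub>2) \<Longrightarrow> \<pi>\<^sub>2 v\<^sub>3 = \<phi> (\<pi>\<^sub>1 u\<^sub>3) \<Longrightarrow>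
      MFT G A \<pi>\<^sub>1 0 (u\<^sub>1 @ u\<^sub>2) u\<^sub>3 \<Longrightarrow> MFT G B \<pi>\<^sub>2 q (v\<^sub>1 @ v\<^sub>2) v\<^sub>3"
    unfolding FT_BRP_def by (metis (no_types))
  interpret cut_transport G A \<pi>\<^sub>1 B \<pi>\<^sub>2 L\<^sub>1 L\<^sub>2 \<phi> q
  proof
    show "\<phi> \<in> hom G G" "factorial_lang L\<^sub>1" by fact+
    show "L\<^sub>1 \<subseteq> lists A" "L\<^sub>2 \<subseteq> lists B" "\<pi>\<^sub>2 ` L\<^sub>2 = carrier G"
      using assms(4,6) by (simp_all add: automatic_structure_def)
    fix u\<^sub>1 u\<^sub>2 v\<^sub>1 v\<^sub>2 v\<^sub>3
    assume L1: "u\<^sub>1 @ u\<^sub>2 \<in> L\<^sub>1" and L2: "v\<^sub>1 \<in> L\<^sub>2" "v\<^sub>2 \<in> L\<^sub>2" "v\<^sub>3 \<in> L\<^sub>2"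
      and eq: "\<pi>\<^sub>2 v\<^sub>1 = \<phi> (\<pi>\<^sub>1 u\<^sub>1)" "\<pi>\<^sub>2 v\<^sub>2 = \<phi> (\<pi>\<^sub>1 u\<^sub>2)" "\<pi>\<^sub>2 v\<^sub>3 = \<phi> (\<pi>\<^sub>1 (u\<^sub>1 @ u\<^sub>2))"
    have "u\<^sub>1 \<in> L\<^sub>1" "u\<^sub>2 \<in> L\<^sub>1"
      using assms(5) L1 unfolding factorial_lang_def by auto
    moreover have "MFT G A \<pi>\<^sub>1 0 (u\<^sub>1 @ u\<^sub>2) (u\<^sub>1 @ u\<^sub>2)"
      by (simp add: MFT_def fellow_travel_def A.dist_self)
    ultimately show "fellow_travel G B \<pi>\<^sub>2 q (v\<^sub>1 @ v\<^sub>2) v\<^sub>3"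
      using q[OF _ _ L1 L2 eq] by (simp add: MFT_def)
  qed
  have "finite (letters B \<pi>\<^sub>2)"
    by (simp add: letters_def B.finite_alphabet)
  then obtain K where K: "\<And>g h. g \<in> carrier G \<Longrightarrow> h \<in> carrier G \<Longrightarrow> S.dist g h \<le> K * B.dist g h"
    using S.dist_le_mult_other_dist[OF B.generated_group_axioms] by blast
  define M where "M = increment_bound + 2 * q"
  define N where "N = Suc (K * M)"
  have "Haus S.dist ((\<phi> \<circ> theta G \<pi>\<^sub>1 x \<alpha>) ` {0..length \<alpha>}) (theta G \<pi>\<^sub>2 (\<phi> x) \<beta> ` {0..length \<beta>})
      \<le> enat N"
    if x: "x \<in> carrier G" and \<alpha>: "\<alpha> \<in> L\<^sub>1" and \<beta>: "\<beta> \<in> L\<^sub>2" "\<pi>\<^sub>2 \<beta> = \<phi> (\<pi>\<^sub>1 \<alpha>)" for x \<alpha> \<beta>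
  proof -
    have transfer: "S.dist ((\<phi> \<circ> theta G \<pi>\<^sub>1 x \<alpha>) i) (theta G \<pi>\<^sub>2 (\<phi> x) \<beta> m) \<le> N"
      if near: "B.dist (\<phi> (\<pi>\<^sub>1 (take i \<alpha>))) (\<pi>\<^sub>2 (take m \<beta>)) \<le> M" for i m
    proof -
      have "take i \<alpha> \<in> lists A" "take m \<beta> \<in> lists B"
        using \<alpha> \<beta>(1) L1_words L2_words A.take_in_lists B.take_in_lists by blast+
      then have carr: "\<pi>\<^sub>1 (take i \<alpha>) \<in> carrier G" "\<pi>\<^sub>2 (take m \<beta>) \<in> carrier G"
        by (auto intro: A.eval_closed B.eval_closed simp del: in_lists_conv_set)
      have \<phi>_carr: "\<phi> x \<in> carrier G" "\<phi> (\<pi>\<^sub>1 (take i \<alpha>)) \<in> carrier G"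
        using hom x carr(1) by (auto simp: hom_def)
      have "S.dist (\<phi> x \<otimes>\<^bsub>G\<^esub> \<phi> (\<pi>\<^sub>1 (take i \<alpha>))) (\<phi> x \<otimes>\<^bsub>G\<^esub> \<pi>\<^sub>2 (take m \<beta>))
          \<le> S.dist (\<phi> (\<pi>\<^sub>1 (take i \<alpha>))) (\<pi>\<^sub>2 (take m \<beta>))"
        using \<phi>_carr carr(2) by (intro S.dist_translate_le)
      also have "\<dots> \<le> K * B.dist (\<phi> (\<pi>\<^sub>1 (take i \<alpha>))) (\<pi>\<^sub>2 (take m \<beta>))"
        using \<phi>_carr carr(2) by (intro K)
      also have "\<dots> \<le> N"
        unfolding N_def using mult_le_mono2[OF near] by (rule le_SucI)
      finally show ?thesis
        using hom_mult[OF hom x carr(1)] by (simp add: theta_def)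
    qed
    show ?thesis
    proof (rule Haus_le)
      fix g assume "g \<in> (\<phi> \<circ> theta G \<pi>\<^sub>1 x \<alpha>) ` {0..length \<alpha>}"
      then obtain i where i: "g = (\<phi> \<circ> theta G \<pi>\<^sub>1 x \<alpha>) i" by blast
      obtain m where "m \<le> length \<beta>" "B.dist (\<phi> (\<pi>\<^sub>1 (take i \<alpha>))) (\<pi>\<^sub>2 (take m \<beta>)) \<le> q"
        using image_of_prefix_near_path[OF \<alpha> \<beta>] by blast
      then show "\<exists>h\<in>theta G \<pi>\<^sub>2 (\<phi> x) \<beta> ` {0..length \<beta>}. S.dist g h \<le> N"
        using transfer[of i m] unfolding i M_def by (intro bexI[OF _ imageI[of m]]) auto
    next
      fix h assume "h \<in> theta G \<pi>\<^sub>2 (\<phi> x) \<beta> ` {0..length \<beta>}"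
      then obtain m where m: "m \<le> length \<beta>" "h = theta G \<pi>\<^sub>2 (\<phi> x) \<beta> m" by auto
      obtain i where "i \<le> length \<alpha>" "B.dist (\<phi> (\<pi>\<^sub>1 (take i \<alpha>))) (\<pi>\<^sub>2 (take m \<beta>)) \<le> M"
        using point_of_path_near_image[OF \<alpha> \<beta> m(1)] unfolding M_def by blast
      then show "\<exists>g\<in>(\<phi> \<circ> theta G \<pi>\<^sub>1 x \<alpha>) ` {0..length \<alpha>}. S.dist g h \<le> N"
        using transfer[of i m] unfolding m(2) by (intro bexI[OF _ imageI[of i]]) auto
    qed
  qed
  moreover have "N > 0" by (simp add: N_def)
  ultimately show ?thesis unfolding BRP_def by blast
qed

end
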